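(* For every $n\ge1$ the following estimates hold for Schatten classes: (i) $n\le\gamma(S_1^n)$. (ii) If $1<p<2$ and $\frac1p+\frac1{p'}=1$, then $n^{1+\frac2{p'}}\le\gamma(S_p^n)$.
   Context: All Banach spaces are complex. $S_p^n$ is the space $M_n$ of complex $n\times n$ matrices with norm $\|A\|=(\mathrm{tr}|A|^p)^{1/p}$, identified with $\mathbb C^{n^2}$ via matrix entries. For $E=(\mathbb C^m,\|\cdot\|)$ with dual norm $\|x\|_*=\sup\{|\sum_jx_jz_j|:\|z\|\le1\}$, $\gamma(E)$ is the infimum of all $c$ such that $\sum_{i,j}a_{ij}b_{ij}\le c\|A\|_\vee\|B\|_\vee$ for all positive semidefinite $m\times m$ matrices $A=(a_{ij})$, $B=(b_{ij})$, where $\|A\|_\vee=\sup\{|\sum a_{ij}x_i\overline{y_j}|:\|x\|_*,\|y\|_*\le1\}$ (injective norm for $E$) and $\|B\|_\vee=\sup\{|\sum b_{ij}z_i\overline{w_j}|:\|z\|,\|w\|\le1\}$ (injective norm for $E^*$). For $E=S_p^n$ one takes $m=n^2$. *)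

theory Defs
  imports "HOL-Analysis.Analysis"
begin

definition mat_adj :: "complex^'n^'m \<Rightarrow> complex^'m^'n" where
  "mat_adj M = (\<chi> i j. cnj (M $ j $ i))"

definition unitary_mat :: "complex^'n^'n \<Rightarrow> bool" where
  "unitary_mat U \<longleftrightarrow> mat_adj U ** U = mat 1 \<and> U ** mat_adj U = mat 1"

definition diag_mat :: "('n::finite \<Rightarrow> real) \<Rightarrow> complex^'n^'n" where
  "diag_mat d = (\<chi> i j. if i = j then complex_of_real (d i) else 0)"

definition psd_mat :: "complex^'n^'n \<Rightarrow> bool" where
  "psd_mat M \<longleftrightarrow> mat_adj M = M \<and>
     (\<forall>x :: complex^'n. 0 \<le> Re (\<Sum>i\<in>UNIV. \<Sum>j\<in>UNIV. cnj (x $ i) * M $ i $ j * x $ j))"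

text \<open>The power \<open>P\<^sup>s\<close> (\<open>s > 0\<close>) of a positive semidefinite \<open>P\<close>, by functional calculus: a
  unitary diagonalisation of \<open>P\<close> exists by the spectral theorem, and the resulting matrix does
  not depend on which one is used.\<close>

definition psd_powr :: "complex^'n^'n \<Rightarrow> real \<Rightarrow> complex^'n^'n" where
  "psd_powr P s = (THE Q. \<exists>U d. unitary_mat U \<and> (\<forall>i. 0 \<le> d i) \<and>
     P = U ** diag_mat d ** mat_adj U \<and>
     Q = U ** diag_mat (\<lambda>i. d i powr s) ** mat_adj U)"

definition mat_abs :: "complex^'n^'n \<Rightarrow> complex^'n^'n" where
  "mat_abs M = psd_powr (mat_adj M ** M) (1/2)"

definition schatten_norm :: "real \<Rightarrow> complex^'n^'n \<Rightarrow> real" where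
  "schatten_norm p M = Re (trace (psd_powr (mat_abs M) p)) powr (1/p)"

text \<open>A vector indexed by \<open>'n \<times> 'n\<close> is read as the matrix with the same entries.\<close>

definition schatten_vec_norm :: "real \<Rightarrow> complex^('n::finite \<times> 'n) \<Rightarrow> real" where
  "schatten_vec_norm p v = schatten_norm p (\<chi> i j. v $ (i, j))"

text \<open>Below, a space \<open>E = (\<complex>\<^sup>m, \<parallel>\<cdot>\<parallel>)\<close> is given by its norm \<open>N\<close>.\<close>

definition dual_norm :: "(complex^'m \<Rightarrow> real) \<Rightarrow> complex^'m \<Rightarrow> real" where
  "dual_norm N x = (SUP z\<in>{z. N z \<le> 1}. cmod (\<Sum>j\<in>UNIV. x $ j * z $ j))"

definition inj_norm :: "(complex^'m \<Rightarrow> real) \<Rightarrow> complex^'m^'m \<Rightarrow> real" where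
  "inj_norm N A = (SUP (x, y)\<in>{x. dual_norm N x \<le> 1} \<times> {y. dual_norm N y \<le> 1}.
     cmod (\<Sum>i\<in>UNIV. \<Sum>j\<in>UNIV. A $ i $ j * x $ i * cnj (y $ j)))"

text \<open>The injective norm for the dual space \<open>E\<^sup>*\<close>, whose dual unit ball is the unit ball of \<open>E\<close>.\<close>

definition inj_norm_dual :: "(complex^'m \<Rightarrow> real) \<Rightarrow> complex^'m^'m \<Rightarrow> real" where
  "inj_norm_dual N B = (SUP (z, w)\<in>{z. N z \<le> 1} \<times> {w. N w \<le> 1}.
     cmod (\<Sum>i\<in>UNIV. \<Sum>j\<in>UNIV. B $ i $ j * z $ i * cnj (w $ j)))"

text \<open>For positive semidefinite (hence Hermitian) \<open>A\<close> and \<open>B\<close> the sum below is a real number;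
  \<open>Re\<close> only changes its type.\<close>

definition gamma_const :: "(complex^'m \<Rightarrow> real) \<Rightarrow> real" where
  "gamma_const N = Inf {c. \<forall>A B. psd_mat A \<longrightarrow> psd_mat B \<longrightarrow>
     Re (\<Sum>i\<in>UNIV. \<Sum>j\<in>UNIV. A $ i $ j * B $ i $ j) \<le> c * inj_norm N A * inj_norm_dual N B}"

end

theory Submission
  imports Defs
begin

text \<open>
  Both lower bounds come from testing the inequality that defines \<open>\<gamma>(E)\<close> on a single pair,
  \<open>A = B = I\<close>, the identity matrix of size \<open>m\<close>. The left-hand side is then \<open>m\<close>, while
  \<open>\<parallel>I\<parallel>\<close> in either injective norm is the squared Euclidean radius of the unit ball over which
  the supremum is taken. Suppose \<open>\<parallel>v\<parallel>\<^sub>2 \<le> N v \<le> K \<parallel>v\<parallel>\<^sub>2\<close> for all \<open>v\<close>. Then the unit ball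
  of \<open>N\<close> lies in the Euclidean ball of radius \<open>1\<close>, and, by duality, the unit ball of the dual norm
  lies in the one of radius \<open>K\<close>. Hence \<open>\<gamma>(E) \<ge> m / K\<^sup>2\<close> (lemma \<open>gamma_const_ge\<close>). The same
  comparison also shows that some constant \<open>c\<close> is admissible at all; this matters because
  the infimum of the empty set of reals carries no information.

  For \<open>E = S\<^sub>p\<^sup>n\<close> with \<open>1 \<le> p \<le> 2\<close> the Euclidean norm is the Hilbert-Schmidt norm. If \<open>d i\<close> are
  the eigenvalues of \<open>M\<^sup>* M\<close>, the two norms are \<open>(\<Sum>i. d i powr (p/2)) powr (1/p)\<close> and
  \<open>(\<Sum>i. d i) powr (1/2)\<close>. Subadditivity and concavity of \<open>x powr (p/2)\<close> give the comparison with
  \<open>K = n powr (1/p - 1/2)\<close> (lemma \<open>schatten_vec_norm_bounds\<close>). Since \<open>m = n\<^sup>2\<close>, the bound is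
  \<open>n powr (3 - 2/p)\<close>, which is \<open>n\<close> for \<open>p = 1\<close> and \<open>n powr (1 + 2/p')\<close> for the conjugate
  exponent \<open>p'\<close>.

  The Schatten norm is given by functional calculus through an arbitrary unitary diagonalization.
  Expressing it by eigenvalues therefore requires that a diagonalization exists (the spectral
  theorem, lemma \<open>gram_matrix_unitary_diagonalization\<close>) and that the power of a matrix does not
  depend on its choice (lemma \<open>diag_powr_unique\<close>).
\<close>

section \<open>The spectral theorem for positive semidefinite matrices\<close>

text \<open>By compactness the quadratic form \<open>y \<bullet> f y\<close> has a maximum on the unit sphere of \<open>W\<close>; a point
  where it is attained is an eigenvector.\<close>

lemma symmetric_eigenvector_exists:
  fixes f :: "'a::euclidean_space \<Rightarrow> 'a"
  assumes f: "linear f" and W: "subspace W" and fW: "\<And>x. x \<in> W \<Longrightarrow> f x \<in> W"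
    and sym: "\<And>x y. x \<in> W \<Longrightarrow> y \<in> W \<Longrightarrow> f x \<bullet> y = x \<bullet> f y"
    and x: "x \<in> W" "x \<noteq> 0"
  obtains v c where "v \<in> W" "norm v = 1" "f v = c *\<^sub>R v"
proof -
  let ?K = "W \<inter> sphere 0 1"
  have "compact ?K"
    by (metis W closed_Int_compact closed_subspace compact_sphere)
  moreover have "x /\<^sub>R norm x \<in> ?K"
    using x W by (auto simp: subspace_mul)
  hence "?K \<noteq> {}" by blast
  moreover have "continuous_on ?K (\<lambda>y. y \<bullet> f y)"
    using f by (intro continuous_on_inner continuous_on_id linear_continuous_on)
      (simp add: linear_conv_bounded_linear)
  ultimately obtain v where "v \<in> ?K" and sup: "\<forall>y\<in>?K. y \<bullet> f y \<le> v \<bullet> f v"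
    using continuous_attains_sup[of ?K "\<lambda>y. y \<bullet> f y"] by blast
  then have v: "v \<in> W" "norm v = 1" by auto
  have max: "y \<bullet> f y \<le> v \<bullet> f v" if "y \<in> W" "norm y = 1" for y
    using sup that by auto
  define c where "c = v \<bullet> f v"
  have quad: "y \<bullet> f y \<le> c * (y \<bullet> y)" if "y \<in> W" for y
  proof (cases "y = 0")
    case False
    define z where "z = y /\<^sub>R norm y"
    have y: "y = norm y *\<^sub>R z" using False by (simp add: z_def)
    have "z \<bullet> f z \<le> c"
      unfolding c_def z_def using that W False by (intro max) (auto simp: subspace_mul)
    then have "(norm y)\<^sup>2 * (z \<bullet> f z) \<le> (norm y)\<^sup>2 * c" by (intro mult_left_mono) auto
    moreover have "y \<bullet> f y = (norm y)\<^sup>2 * (z \<bullet> f z)"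
      by (subst (1 2) y) (simp only: linear_cmul[OF f] inner_scaleR_left inner_scaleR_right
          power2_eq_square mult.assoc)
    ultimately show ?thesis by (simp add: power2_norm_eq_inner mult.commute)
  qed (simp add: linear_0[OF f])
  define w where "w = c *\<^sub>R v - f v"
  have wW: "w \<in> W"
    unfolding w_def using v fW W by (auto intro: subspace_diff subspace_mul)
  \<comment> \<open>The form \<open>c (y \<bullet> y) - y \<bullet> f y\<close> is nonnegative on \<open>W\<close> and vanishes at \<open>v\<close>, so its first-order
    term in the direction \<open>w\<close>, which is \<open>2 (w \<bullet> w)\<close>, has to vanish as well.\<close>
  define q where "q = c * (w \<bullet> w) - w \<bullet> f w"
  have pos: "0 \<le> 2 * t * (w \<bullet> w) + t\<^sup>2 * q" for t
  proof -
    let ?y = "v + t *\<^sub>R w"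
    have "?y \<in> W" using v wW W by (auto intro: subspace_add subspace_mul)
    from quad[OF this] have "0 \<le> c * (?y \<bullet> ?y) - ?y \<bullet> f ?y" by simp
    also have "\<dots> = (c * (v \<bullet> v) - v \<bullet> f v) + 2 * t * (c * (w \<bullet> v) - w \<bullet> f v) + t\<^sup>2 * q"
      using sym[OF v(1) wW] f unfolding q_def
      by (simp add: linear_add linear_cmul inner_add_left inner_add_right algebra_simps
          power2_eq_square inner_commute)
    also have "c * (v \<bullet> v) - v \<bullet> f v = 0"
      using v by (simp add: c_def power2_norm_eq_inner[symmetric])
    also have "c * (w \<bullet> v) - w \<bullet> f v = w \<bullet> w"
      by (simp add: w_def inner_diff_left inner_diff_right algebra_simps)
    finally show ?thesis by simp
  qed
  have "w \<bullet> w \<le> 0"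
  proof (cases "q \<le> 0")
    case True
    then show ?thesis using pos[of "-1"] by simp
  next
    case False
    then show ?thesis using pos[of "- (w \<bullet> w) / q"]
      by (auto simp: power2_eq_square divide_le_0_iff mult_le_0_iff)
  qed
  then have "w = 0" by (metis inner_gt_zero_iff not_less)
  then have "f v = c *\<^sub>R v" by (simp add: w_def)
  with v that show thesis by blast
qed

definition cdot :: "complex^'n \<Rightarrow> complex^'n \<Rightarrow> complex" where
  "cdot x y = (\<Sum>i\<in>UNIV. cnj (x $ i) * y $ i)"

lemma cdot_simps:
  "cdot x (y + z) = cdot x y + cdot x z" "cdot (c *s x) y = cnj c * cdot x y"
  "cdot (r *\<^sub>R x) y = of_real r * cdot x y" "cdot x (r *\<^sub>R y) = of_real r * cdot x y"
  "cdot x 0 = 0"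
  by (auto simp: cdot_def algebra_simps sum.distrib sum_distrib_left
      scaleR_conv_of_real[where 'a = complex])

lemma cdot_commute: "cdot y x = cnj (cdot x y)"
  by (simp add: cdot_def mult.commute)

lemma Re_cdot: "Re (cdot x y) = x \<bullet> y"
  by (simp add: cdot_def inner_vec_def inner_complex_def)

lemma cdot_self: "cdot x x = of_real ((norm x)\<^sup>2)"
proof -
  have "Im (cdot x x) = 0" using cdot_commute[of x x] by (metis Reals_cnj_iff complex_is_Real_iff)
  moreover have "Re (cdot x x) = (norm x)\<^sup>2" by (simp add: Re_cdot power2_norm_eq_inner)
  ultimately show ?thesis by (simp add: complex_eq_iff)
qed

lemma cdot_mat_adj: "cdot (A *v x) y = cdot x (mat_adj A *v y)"
proof -
  have "cdot (A *v x) y = (\<Sum>i\<in>UNIV. \<Sum>j\<in>UNIV. cnj (A $ i $ j) * cnj (x $ j) * y $ i)"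
    by (simp add: cdot_def matrix_vector_mult_def sum_distrib_right)
  also have "\<dots> = (\<Sum>j\<in>UNIV. \<Sum>i\<in>UNIV. cnj (A $ i $ j) * cnj (x $ j) * y $ i)"
    by (rule sum.swap)
  also have "\<dots> = cdot x (mat_adj A *v y)"
    by (simp add: cdot_def matrix_vector_mult_def mat_adj_def sum_distrib_left mult_ac)
  finally show ?thesis .
qed

lemma mat_adj_mult: "mat_adj (A ** B) = mat_adj B ** mat_adj A"
  by (simp add: mat_adj_def matrix_matrix_mult_def vec_eq_iff mult.commute)

lemma mat_adj_mat_adj [simp]: "mat_adj (mat_adj A) = A"
  by (simp add: mat_adj_def vec_eq_iff)

text \<open>Induction over a set \<open>J\<close> of indices lets the number of eigenvectors grow while the dimension,
  which is a type, stays fixed. A new eigenvector is found in the orthogonal complement of the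
  previous ones, which is invariant because \<open>P\<close> is Hermitian. The real statement above applies
  there, as the real part of \<open>cdot\<close> is the real inner product.\<close>

lemma hermitian_orthonormal_eigenvectors:
  fixes P :: "complex^'n^'n" and J :: "'n set"
  assumes P: "mat_adj P = P"
  shows "\<exists>u c. (\<forall>i\<in>J. \<forall>j\<in>J. cdot (u i) (u j) = (if i = j then 1 else 0)) \<and>
     (\<forall>i\<in>J. P *v u i = c i *\<^sub>R u i)"
proof -
  have "finite J" by simp
  then show ?thesis
  proof (induction J rule: finite_induct)
    case empty
    then show ?case by simp
  next
    case (insert k J)
    obtain u c where on: "\<And>i j. i \<in> J \<Longrightarrow> j \<in> J \<Longrightarrow> cdot (u i) (u j) = (if i = j then 1 else 0)"
      and ev: "\<And>i. i \<in> J \<Longrightarrow> P *v u i = c i *\<^sub>R u i"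
      using insert.IH by blast
    define W where "W = {x. \<forall>j\<in>J. cdot (u j) x = 0}"
    have W: "subspace W"
      by (auto simp: W_def subspace_def cdot_simps)
    \<comment> \<open>Over the reals, complex orthogonality to \<open>u j\<close> means orthogonality to both \<open>u j\<close> and
      \<open>\<i> *s u j\<close>.\<close>
    define S where "S = u ` J \<union> (\<lambda>j. \<i> *s u j) ` J"
    have "J \<subset> UNIV" using insert.hyps by auto
    hence "card J < CARD('n)" by (simp add: psubset_card_mono)
    moreover have "card S \<le> card J + card J"
      unfolding S_def using insert.hyps
      by (intro order.trans[OF card_Un_le] add_mono card_image_le)
    moreover have "dim S \<le> card S" by (rule dim_le_card') (simp add: S_def insert.hyps)
    ultimately have "dim S < DIM(complex^'n)" by simp
    then obtain x where x: "x \<noteq> 0" "\<And>y. y \<in> span S \<Longrightarrow> orthogonal x y"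
      by (rule orthogonal_to_subspace_exists) blast
    have "x \<in> W" unfolding W_def
    proof safe
      fix j assume j: "j \<in> J"
      have "Re (cdot (u j) x) = 0" "Re (cdot (\<i> *s u j) x) = 0"
        using x(2)[OF span_base, of "u j"] x(2)[OF span_base, of "\<i> *s u j"] j
        by (auto simp: S_def Re_cdot orthogonal_def inner_commute)
      then show "cdot (u j) x = 0" by (simp add: cdot_simps complex_eq_iff)
    qed
    moreover have "P *v y \<in> W" if "y \<in> W" for y unfolding W_def
    proof safe
      fix j assume "j \<in> J"
      then show "cdot (u j) (P *v y) = 0"
        using cdot_mat_adj[of P "u j" y] that by (simp add: P ev cdot_simps W_def)
    qed
    moreover have "(P *v y) \<bullet> z = y \<bullet> (P *v z)" for y z
      using cdot_mat_adj[of P y z] by (simp add: P Re_cdot[symmetric])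
    moreover have "linear ((*v) P)" 
      by (intro linearI) (simp_all add: matrix_vector_mult_def vec_eq_iff sum.distrib sum_distrib_left
          scaleR_conv_of_real[where 'a = complex] algebra_simps)
    ultimately obtain v d where v: "v \<in> W" "norm v = 1" "P *v v = d *\<^sub>R v"
      using symmetric_eigenvector_exists[of "(*v) P" W x] W x(1) by blast
    have v0: "cdot (u j) v = 0" "cdot v (u j) = 0" if "j \<in> J" for j
      using v(1) that cdot_commute[of v "u j"] by (auto simp: W_def)
    have vv: "cdot v v = 1" using v(2) by (simp add: cdot_self)
    show ?case
    proof (intro exI conjI ballI)
      fix i j assume "i \<in> insert k J" "j \<in> insert k J"
      then show "cdot ((u(k := v)) i) ((u(k := v)) j) = (if i = j then 1 else 0)"
        using on[of i j] v0 vv by (cases "i = k"; cases "j = k"; simp)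
    next
      fix i assume "i \<in> insert k J"
      then show "P *v (u(k := v)) i = (c(k := d)) i *\<^sub>R (u(k := v)) i"
        using ev[of i] v(3) by (cases "i = k"; simp)
    qed
  qed
qed

lemma matrix_mult_diag_mat: "(A ** diag_mat d) $ i $ j = A $ i $ j * of_real (d j)"
proof -
  have "(A ** diag_mat d) $ i $ j = (\<Sum>k\<in>UNIV. if k = j then A $ i $ j * of_real (d j) else 0)"
    unfolding matrix_matrix_mult_def diag_mat_def by (simp add: if_distrib cong: if_cong)
  then show ?thesis by simp
qed

lemma diag_mat_mult_matrix: "(diag_mat d ** A) $ i $ j = of_real (d i) * A $ i $ j"
proof -
  have "(diag_mat d ** A) $ i $ j = (\<Sum>k\<in>UNIV. diag_mat d $ i $ k * A $ k $ j)"
    by (simp add: matrix_matrix_mult_def)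
  also have "\<dots> = (\<Sum>k\<in>UNIV. if k = i then of_real (d i) * A $ i $ j else 0)"
    by (intro sum.cong) (auto simp: diag_mat_def)
  finally show ?thesis by simp
qed

text \<open>The eigenvalues are nonnegative because the quadratic form of \<open>M\<^sup>* M\<close> at \<open>x\<close> is
  \<open>\<parallel>M x\<parallel>\<^sup>2\<close>.\<close>

lemma gram_matrix_unitary_diagonalization:
  fixes M :: "complex^'n^'n"
  obtains U d where "unitary_mat U" "\<And>i. 0 \<le> d i" "mat_adj M ** M = U ** diag_mat d ** mat_adj U"
proof -
  define P where "P = mat_adj M ** M"
  have P: "mat_adj P = P" by (simp add: P_def mat_adj_mult)
  obtain u and d :: "'n \<Rightarrow> real" where ud: "\<forall>i\<in>UNIV. \<forall>j\<in>UNIV. cdot (u i) (u j) = (if i = j then 1 else 0)"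
    "\<forall>i\<in>UNIV. P *v u i = d i *\<^sub>R u i"
    using hermitian_orthonormal_eigenvectors[OF P, of UNIV] by blast
  then have on: "cdot (u i) (u j) = (if i = j then 1 else 0)"
    and ev: "P *v u i = d i *\<^sub>R u i" for i j by auto
  define U where "U = (\<chi> i j. u j $ i)"
  have "mat_adj U ** U = mat 1"
    using on by (simp add: vec_eq_iff mat_adj_def U_def matrix_matrix_mult_def mat_def cdot_def)
  then have U: "unitary_mat U"
    by (simp add: unitary_mat_def matrix_left_right_inverse)
  have "P ** U = U ** diag_mat d"
  proof -
    have "(P ** U) $ i $ j = (P *v u j) $ i" for i j
      by (simp add: U_def matrix_matrix_mult_def matrix_vector_mult_def)
    then show ?thesis
      by (simp add: vec_eq_iff matrix_mult_diag_mat ev) (simp add: U_def scaleR_conv_of_real mult.commute)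
  qed
  then have "P = U ** diag_mat d ** mat_adj U"
    using U by (metis matrix_mul_assoc matrix_mul_rid unitary_mat_def)
  moreover have "0 \<le> d i" for i
  proof -
    have "of_real (d i) = cdot (u i) (P *v u i)" by (simp add: ev cdot_simps on)
    also have "\<dots> = cdot (M *v u i) (M *v u i)"
      by (simp add: P_def cdot_mat_adj matrix_vector_mul_assoc)
    also have "\<dots> = of_real ((norm (M *v u i))\<^sup>2)" by (rule cdot_self)
    finally show ?thesis by (simp only: of_real_eq_iff) simp
  qed
  ultimately show thesis using that U unfolding P_def by blast
qed

lemma diag_powr_unique:
  assumes U: "unitary_mat U" and V: "unitary_mat V"
    and eq: "U ** diag_mat d ** mat_adj U = V ** diag_mat e ** mat_adj V"
  shows "U ** diag_mat (\<lambda>i. d i powr s) ** mat_adj U = V ** diag_mat (\<lambda>i. e i powr s) ** mat_adj V"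
proof -
  have V': "mat_adj V ** (V ** X) = X" "V ** (mat_adj V ** X) = X" for X
    using V by (simp_all add: unitary_mat_def matrix_mul_assoc)
  have U': "mat_adj U ** U = mat 1" "U ** mat_adj U = mat 1"
    using U by (simp_all add: unitary_mat_def)
  define W where "W = mat_adj V ** U"
  have "W ** diag_mat d = mat_adj V ** (U ** diag_mat d ** mat_adj U) ** U"
    by (simp add: W_def matrix_mul_assoc[symmetric] U')
  also have "\<dots> = diag_mat e ** W"
    unfolding eq by (simp add: W_def matrix_mul_assoc[symmetric] V')
  finally have "W $ i $ j * of_real (d j) = of_real (e i) * W $ i $ j" for i j
    by (metis matrix_mult_diag_mat diag_mat_mult_matrix)
  \<comment> \<open>\<open>W\<close> links only equal eigenvalues, so it also intertwines their powers.\<close>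
  then have "W $ i $ j = 0 \<or> d j = e i" for i j
    by (metis mult.commute mult_cancel_left of_real_eq_iff)
  then have "W $ i $ j * of_real (d j powr s) = of_real (e i powr s) * W $ i $ j" for i j
    by (metis mult.commute mult_zero_left)
  then have W: "W ** diag_mat (\<lambda>i. d i powr s) = diag_mat (\<lambda>i. e i powr s) ** W"
    by (simp add: vec_eq_iff matrix_mult_diag_mat diag_mat_mult_matrix)
  have "U ** diag_mat (\<lambda>i. d i powr s) ** mat_adj U =
      V ** (W ** diag_mat (\<lambda>i. d i powr s)) ** mat_adj U"
    by (simp add: W_def matrix_mul_assoc[symmetric] V')
  also have "\<dots> = V ** diag_mat (\<lambda>i. e i powr s) ** mat_adj V"
    unfolding W by (simp add: W_def matrix_mul_assoc[symmetric] U')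
  finally show ?thesis .
qed

lemma psd_powr_diagonalized:
  assumes "unitary_mat U" "\<And>i. 0 \<le> d i"
  shows "psd_powr (U ** diag_mat d ** mat_adj U) s = U ** diag_mat (\<lambda>i. d i powr s) ** mat_adj U"
  unfolding psd_powr_def
proof (rule the_equality)
  show "\<exists>V e. unitary_mat V \<and> (\<forall>i. 0 \<le> e i) \<and>
      U ** diag_mat d ** mat_adj U = V ** diag_mat e ** mat_adj V \<and>
      U ** diag_mat (\<lambda>i. d i powr s) ** mat_adj U = V ** diag_mat (\<lambda>i. e i powr s) ** mat_adj V"
    using assms by blast
next
  fix Q
  assume "\<exists>V e. unitary_mat V \<and> (\<forall>i. 0 \<le> e i) \<and>
      U ** diag_mat d ** mat_adj U = V ** diag_mat e ** mat_adj V \<and>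
      Q = V ** diag_mat (\<lambda>i. e i powr s) ** mat_adj V"
  then show "Q = U ** diag_mat (\<lambda>i. d i powr s) ** mat_adj U"
    using diag_powr_unique assms(1) by metis
qed

section \<open>Schatten norms and the Euclidean norm\<close>

lemma trace_diagonalized:
  assumes "unitary_mat U"
  shows "Re (trace (U ** diag_mat d ** mat_adj U)) = (\<Sum>i\<in>UNIV. d i)"
proof -
  have "trace (U ** diag_mat d ** mat_adj U) = trace (mat_adj U ** (U ** diag_mat d))"
    by (rule trace_mul_sym)
  also have "mat_adj U ** (U ** diag_mat d) = diag_mat d"
    using assms by (simp add: matrix_mul_assoc unitary_mat_def)
  finally show ?thesis by (simp add: trace_def diag_mat_def)
qed

text \<open>One family \<open>d\<close>, the squared singular values of \<open>M\<close>, serves all exponents at once; the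
  Hilbert-Schmidt norm enters because its square is the trace of \<open>M\<^sup>* M\<close>.\<close>

lemma schatten_norm_squared_singular_values:
  fixes M :: "complex^'n^'n"
  obtains d where "\<And>i. 0 \<le> d i"
    "\<And>p. schatten_norm p M = (\<Sum>i\<in>UNIV. d i powr (p / 2)) powr (1 / p)"
    "(\<Sum>i\<in>UNIV. \<Sum>j\<in>UNIV. (cmod (M $ i $ j))\<^sup>2) = (\<Sum>i\<in>(UNIV :: 'n set). d i)"
proof -
  obtain U d where U: "unitary_mat U" and d: "\<And>i. 0 \<le> d i"
    and M: "mat_adj M ** M = U ** diag_mat d ** mat_adj U"
    by (rule gram_matrix_unitary_diagonalization[of M]) blast
  have "schatten_norm p M = (\<Sum>i\<in>UNIV. d i powr (p / 2)) powr (1 / p)" for p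
    unfolding schatten_norm_def mat_abs_def M
    by (simp add: psd_powr_diagonalized U d trace_diagonalized powr_powr)
  moreover have "(\<Sum>i\<in>UNIV. \<Sum>j\<in>UNIV. (cmod (M $ i $ j))\<^sup>2) = Re (trace (mat_adj M ** M))"
  proof -
    have "Re (trace (mat_adj M ** M)) = (\<Sum>j\<in>UNIV. \<Sum>i\<in>UNIV. (cmod (M $ i $ j))\<^sup>2)"
      by (simp add: trace_def matrix_matrix_mult_def mat_adj_def cmod_power2)
        (simp add: power2_eq_square)
    also have "\<dots> = (\<Sum>i\<in>UNIV. \<Sum>j\<in>UNIV. (cmod (M $ i $ j))\<^sup>2)" by (rule sum.swap)
    finally show ?thesis ..
  qed
  then have "(\<Sum>i\<in>UNIV. \<Sum>j\<in>UNIV. (cmod (M $ i $ j))\<^sup>2) = (\<Sum>i\<in>UNIV. d i)"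
    unfolding M trace_diagonalized[OF U] .
  ultimately show thesis by (intro that[of d] d)
qed

text \<open>After normalizing the sum to \<open>1\<close> every term lies in \<open>[0, 1]\<close>, where \<open>x \<le> x powr q\<close>.\<close>

lemma powr_sum_le_sum_powr:
  fixes d :: "'i \<Rightarrow> real"
  assumes I: "finite I" and d: "\<And>i. i \<in> I \<Longrightarrow> 0 \<le> d i" and q: "0 < q" "q \<le> 1"
  shows "(\<Sum>i\<in>I. d i) powr q \<le> (\<Sum>i\<in>I. d i powr q)"
proof (cases "(\<Sum>i\<in>I. d i) = 0")
  case True
  then show ?thesis by (simp add: sum_nonneg)
next
  case False
  define S where "S = (\<Sum>i\<in>I. d i)"
  have S: "S > 0" using False sum_nonneg[of I d] d unfolding S_def by fastforce
  have "d i / S * S powr q \<le> d i powr q" if i: "i \<in> I" for i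
  proof -
    have "d i \<le> S" unfolding S_def using I d i by (intro member_le_sum) auto
    then have "(d i / S) powr 1 \<le> (d i / S) powr q"
      using S d i q by (intro powr_mono') auto
    then show ?thesis using S d[OF i] by (simp add: powr_divide field_simps)
  qed
  then have "(\<Sum>i\<in>I. d i / S * S powr q) \<le> (\<Sum>i\<in>I. d i powr q)" by (rule sum_mono)
  also have "(\<Sum>i\<in>I. d i / S * S powr q) = S powr q"
    using S by (simp add: sum_distrib_right[symmetric] sum_divide_distrib[symmetric] S_def)
  finally show ?thesis by (simp add: S_def)
qed

lemma sum_powr_le_card_powr:
  fixes d :: "'i \<Rightarrow> real"
  assumes I: "finite I" and d: "\<And>i. i \<in> I \<Longrightarrow> 0 \<le> d i" and q: "0 < q" "q \<le> 1"
  shows "(\<Sum>i\<in>I. d i powr q) \<le> real (card I) powr (1 - q) * (\<Sum>i\<in>I. d i) powr q"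
proof (cases "(\<Sum>i\<in>I. d i) = 0")
  case True
  then show ?thesis using I d by (simp add: sum_nonneg_eq_0_iff)
next
  case False
  define m where "m = (\<Sum>i\<in>I. d i) / card I"
  have n: "real (card I) > 0" using False I by (metis card_gt_0_iff of_nat_0_less_iff sum.empty)
  have m: "m > 0" using False sum_nonneg[of I d] d n unfolding m_def by fastforce
  \<comment> \<open>Each power lies below the tangent of \<open>x \<mapsto> x powr q\<close> at the mean \<open>m\<close>.\<close>
  have "d i powr q \<le> m powr q * (q * (d i / m) + (1 - q))" if i: "i \<in> I" for i
  proof (cases "d i = 0")
    case False
    have "(d i / m) powr q * 1 powr (1 - q) \<le> q * (d i / m) + (1 - q) * 1"
      using False d[OF i] m q by (intro Youngs_inequality_0) auto
    then show ?thesis using m d[OF i] by (simp add: powr_divide field_simps)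
  qed (use q in auto)
  then have "(\<Sum>i\<in>I. d i powr q) \<le> (\<Sum>i\<in>I. m powr q * (q * (d i / m) + (1 - q)))"
    by (rule sum_mono)
  also have "\<dots> = m powr q * (q * ((\<Sum>i\<in>I. d i) / m) + card I * (1 - q))"
    by (simp add: sum_distrib_left[symmetric] sum.distrib sum_divide_distrib[symmetric])
  also have "(\<Sum>i\<in>I. d i) / m = card I" using False n by (simp add: m_def)
  also have "m powr q * (q * card I + card I * (1 - q)) = m powr q * card I"
    by (simp add: algebra_simps)
  also have "\<dots> = real (card I) powr (1 - q) * (\<Sum>i\<in>I. d i) powr q"
    using n sum_nonneg[of I d] d by (simp add: m_def powr_divide powr_diff field_simps)
  finally show ?thesis .
qed

lemma schatten_vec_norm_bounds:
  fixes v :: "complex^('n::finite \<times> 'n)"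
  assumes p: "1 \<le> p" "p \<le> 2"
  shows "norm v \<le> schatten_vec_norm p v"
    and "schatten_vec_norm p v \<le> real CARD('n) powr (1 / p - 1 / 2) * norm v"
proof -
  obtain d where d: "\<And>i. 0 \<le> d i"
    and N: "schatten_vec_norm p v = (\<Sum>i\<in>UNIV. d i powr (p / 2)) powr (1 / p)"
    and "(\<Sum>i\<in>UNIV. \<Sum>j\<in>UNIV. (cmod (v $ (i, j)))\<^sup>2) = (\<Sum>i\<in>(UNIV::'n set). d i)"
    unfolding schatten_vec_norm_def
    by (rule schatten_norm_squared_singular_values[of "\<chi> i j. v $ (i, j)"]) auto
  then have "(\<Sum>k\<in>UNIV. (cmod (v $ k))\<^sup>2) = (\<Sum>i\<in>UNIV. d i)"
    by (simp add: sum.cartesian_product)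
  then have v: "norm v = (\<Sum>i\<in>UNIV. d i) powr (1 / 2)"
    by (simp add: norm_vec_def L2_set_def powr_half_sqrt sum_nonneg d)
  have "norm v = ((\<Sum>i\<in>UNIV. d i) powr (p / 2)) powr (1 / p)"
    using p by (simp add: v powr_powr)
  also have "\<dots> \<le> schatten_vec_norm p v"
    unfolding N using p d by (intro powr_mono2 powr_sum_le_sum_powr) auto
  finally show "norm v \<le> schatten_vec_norm p v" .
  have "schatten_vec_norm p v \<le>
      (real CARD('n) powr (1 - p / 2) * (\<Sum>i\<in>UNIV. d i) powr (p / 2)) powr (1 / p)"
    unfolding N using p d by (intro powr_mono2 sum_powr_le_card_powr sum_nonneg) auto
  also have "\<dots> = real CARD('n) powr ((1 - p / 2) * (1 / p)) * norm v"
    using p by (simp add: powr_mult powr_powr v)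
  also have "(1 - p / 2) * (1 / p) = 1 / p - 1 / 2"
    using p by (simp add: field_simps)
  finally show "schatten_vec_norm p v \<le> real CARD('n) powr (1 / p - 1 / 2) * norm v" .
qed

section \<open>The constant of a norm that is close to the Euclidean norm\<close>

lemma cmod_sum_mult_le_norm: "cmod (\<Sum>j\<in>UNIV. x $ j * y $ j) \<le> norm x * norm (y :: complex^'m)"
proof -
  have "cmod (\<Sum>j\<in>UNIV. x $ j * y $ j) \<le> (\<Sum>j\<in>UNIV. \<bar>cmod (x $ j)\<bar> * \<bar>cmod (y $ j)\<bar>)"
    by (rule sum_norm_le) (simp add: norm_mult)
  also have "\<dots> \<le> norm x * norm y"
    unfolding norm_vec_def by (rule L2_set_mult_ineq)
  finally show ?thesis .
qed

text \<open>Both injective norms have this shape: \<open>S\<close> is the unit ball of the dual norm for the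
  norm of \<open>E\<close>, and the unit ball of \<open>E\<close> for that of the dual space.\<close>

definition sesq_sup :: "(complex^'m) set \<Rightarrow> complex^'m^'m \<Rightarrow> real" where
  "sesq_sup S A = (SUP (x, y)\<in>S \<times> S.
     cmod (\<Sum>i\<in>UNIV. \<Sum>j\<in>UNIV. A $ i $ j * x $ i * cnj (y $ j)))"

lemma inj_norm_eq_sesq_sup: "inj_norm N A = sesq_sup {x. dual_norm N x \<le> 1} A"
  and inj_norm_dual_eq_sesq_sup: "inj_norm_dual N A = sesq_sup {x. N x \<le> 1} A"
  by (simp_all add: inj_norm_def inj_norm_dual_def sesq_sup_def)

lemma norm_axis: "norm (axis k c :: 'a::real_normed_vector^'m) = norm c"
proof -
  have "(\<Sum>i\<in>UNIV. (norm ((axis k c :: 'a^'m) $ i))\<^sup>2) = (\<Sum>i\<in>UNIV. if i = k then (norm c)\<^sup>2 else 0)"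
    by (intro sum.cong) (auto simp: axis_def)
  then show ?thesis by (simp add: norm_vec_def L2_set_def)
qed

text \<open>The entries are values of the form at multiples of unit vectors. The hypothesis
  \<open>S \<subseteq> cball 0 R\<close> makes the supremum finite, so that it dominates these values.\<close>

lemma entry_le_sesq_sup:
  fixes A :: "complex^'m^'m"
  assumes S: "S \<subseteq> cball 0 R" and r: "cball 0 r \<subseteq> S" "0 < r"
  shows "r\<^sup>2 * cmod (A $ k $ l) \<le> sesq_sup S A"
proof -
  let ?f = "\<lambda>(x, y). cmod (\<Sum>i\<in>UNIV. \<Sum>j\<in>UNIV. A $ i $ j * x $ i * cnj (y $ j))"
  have "bdd_above (?f ` (S \<times> S))"
  proof (rule bdd_aboveI2, safe)
    fix x y assume "x \<in> S" "y \<in> S"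
    then have xy: "norm x \<le> R" "norm y \<le> R" using S by auto
    have "cmod (\<Sum>i\<in>UNIV. \<Sum>j\<in>UNIV. A $ i $ j * x $ i * cnj (y $ j))
      \<le> (\<Sum>i\<in>UNIV. \<Sum>j\<in>UNIV. cmod (A $ i $ j) * R * R)"
    proof (intro sum_norm_le)
      fix i j
      have "cmod (x $ i) \<le> R" "cmod (y $ j) \<le> R"
        using xy component_le_norm_cart order_trans Finite_Cartesian_Product.norm_nth_le by blast+
      then show "cmod (A $ i $ j * x $ i * cnj (y $ j)) \<le> cmod (A $ i $ j) * R * R"
        by (simp add: norm_mult mult_mono order_trans[OF norm_ge_zero])
    qed
    then show "cmod (\<Sum>i\<in>UNIV. \<Sum>j\<in>UNIV. A $ i $ j * x $ i * cnj (y $ j))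
      \<le> (\<Sum>i\<in>UNIV. \<Sum>j\<in>UNIV. cmod (A $ i $ j) * R * R)" .
  qed
  moreover have "(axis k (of_real r), axis l (of_real r)) \<in> S \<times> S"
    using r(2) by (auto intro!: subsetD[OF r(1)] simp: norm_axis)
  ultimately have "?f (axis k (of_real r), axis l (of_real r)) \<le> sesq_sup S A"
    unfolding sesq_sup_def by (intro cSUP_upper)
  moreover have "?f (axis k (of_real r), axis l (of_real r)) = r\<^sup>2 * cmod (A $ k $ l)"
  proof -
    have inner: "(\<Sum>j\<in>UNIV. A $ i $ j * x * cnj (axis l (of_real r) $ j)) = A $ i $ l * x * of_real r"
      for i x
    proof -
      have "(\<Sum>j\<in>UNIV. A $ i $ j * x * cnj (axis l (of_real r) $ j))
        = (\<Sum>j\<in>UNIV. if j = l then A $ i $ l * x * of_real r else 0)"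
        by (intro sum.cong) (auto simp: axis_def)
      then show ?thesis by simp
    qed
    have "(\<Sum>i\<in>UNIV. \<Sum>j\<in>UNIV. A $ i $ j * axis k (of_real r) $ i * cnj (axis l (of_real r) $ j))
      = (\<Sum>i\<in>UNIV. if i = k then A $ k $ l * of_real r * of_real r else 0)"
      unfolding inner by (intro sum.cong) (auto simp: axis_def)
    also have "\<dots> = A $ k $ l * of_real r * of_real r" by simp
    finally show ?thesis using r(2) by (simp add: norm_mult power2_eq_square)
  qed
  ultimately show ?thesis by simp
qed

lemma sesq_sup_mat_1_le:
  assumes S: "S \<subseteq> cball 0 R" "S \<noteq> {}"
  shows "sesq_sup S (mat 1 :: complex^'m^'m) \<le> R\<^sup>2"
  unfolding sesq_sup_def
proof (rule cSUP_least, safe)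
  fix x y assume xy: "x \<in> S" "y \<in> S"
  have "(\<Sum>i\<in>UNIV. \<Sum>j\<in>UNIV. mat 1 $ i $ j * x $ i * cnj (y $ j)) =
      (\<Sum>i\<in>UNIV. \<Sum>j\<in>UNIV. if i = j then x $ i * cnj (y $ i) else 0)"
    by (intro sum.cong) (auto simp: mat_def)
  also have "\<dots> = (\<Sum>i\<in>UNIV. x $ i * (\<chi> i. cnj (y $ i)) $ i)" by simp
  finally have "cmod (\<Sum>i\<in>UNIV. \<Sum>j\<in>UNIV. mat 1 $ i $ j * x $ i * cnj (y $ j))
      \<le> norm x * norm (\<chi> i. cnj (y $ i))"
    using cmod_sum_mult_le_norm by metis
  also have "norm (\<chi> i. cnj (y $ i)) = norm y" by (simp add: norm_vec_def)
  also have "norm x * norm y \<le> R * R"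
    using xy S by (intro mult_mono) (auto intro: order_trans[OF norm_ge_zero])
  finally show "cmod (\<Sum>i\<in>UNIV. \<Sum>j\<in>UNIV. mat 1 $ i $ j * x $ i * cnj (y $ j)) \<le> R\<^sup>2"
    by (simp add: power2_eq_square)
qed (use S in auto)

lemma dual_norm_bounds:
  fixes N :: "complex^'m \<Rightarrow> real"
  assumes lo: "\<And>v. norm v \<le> N v" and hi: "\<And>v. N v \<le> K * norm v" and K: "0 < K"
  shows "dual_norm N x \<le> norm x" and "norm x \<le> K * dual_norm N x"
proof -
  let ?f = "\<lambda>z. cmod (\<Sum>j\<in>UNIV. x $ j * z $ j)"
  have N0: "N 0 \<le> 1" using hi[of 0] by simp
  have ub: "?f z \<le> norm x" if "N z \<le> 1" for z
  proof -
    have "?f z \<le> norm x * norm z" by (rule cmod_sum_mult_le_norm)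
    also have "\<dots> \<le> norm x * 1" using lo[of z] that by (intro mult_left_mono) auto
    finally show ?thesis by simp
  qed
  show "dual_norm N x \<le> norm x"
    unfolding dual_norm_def using ub N0 by (intro cSUP_least) auto
  have le_dual: "?f z \<le> dual_norm N x" if "N z \<le> 1" for z
    unfolding dual_norm_def using ub that by (intro cSUP_upper bdd_aboveI2) auto
  show "norm x \<le> K * dual_norm N x"
  proof (cases "x = 0")
    case True
    then show ?thesis using le_dual[OF N0] K by simp
  next
    case False
    \<comment> \<open>Test against the conjugate of \<open>x\<close>, scaled to have Euclidean norm \<open>1 / K\<close>.\<close>
    define z where "z = (1 / (K * norm x)) *\<^sub>R (\<chi> j. cnj (x $ j))"
    have "norm z = 1 / K"
    proof -
      have "norm (\<chi> j. cnj (x $ j)) = norm x" by (simp add: norm_vec_def)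
      then show ?thesis using False K by (simp add: z_def)
    qed
    then have "N z \<le> 1" using hi[of z] K by simp
    moreover have "(\<Sum>j\<in>UNIV. x $ j * z $ j) = of_real (norm x / K)"
    proof -
      have "(\<Sum>j\<in>UNIV. x $ j * z $ j) = of_real (1 / (K * norm x)) * cdot x x"
        by (simp add: z_def cdot_def sum_distrib_left scaleR_conv_of_real[where 'a = complex] mult_ac)
      also have "\<dots> = of_real (norm x / K)"
        using False K by (simp only: cdot_self of_real_mult[symmetric]) (simp add: power2_eq_square)
      finally show ?thesis .
    qed
    ultimately have "norm x / K \<le> dual_norm N x"
      using le_dual[of z] K by (simp add: norm_divide)
    then show ?thesis using K by (simp add: field_simps)
  qed
qed

lemma psd_mat_1: "psd_mat (mat 1 :: complex^'m^'m)"
proof -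
  have "(\<Sum>i\<in>UNIV. \<Sum>j\<in>UNIV. cnj (x $ i) * (mat 1 :: complex^'m^'m) $ i $ j * x $ j) = cdot x x" for x
  proof -
    have "(\<Sum>i\<in>UNIV. \<Sum>j\<in>UNIV. cnj (x $ i) * (mat 1 :: complex^'m^'m) $ i $ j * x $ j)
      = (\<Sum>i\<in>UNIV. \<Sum>j\<in>UNIV. if i = j then cnj (x $ i) * x $ i else 0)"
      by (intro sum.cong) (auto simp: mat_def)
    then show ?thesis by (simp add: cdot_def)
  qed
  then show ?thesis
    by (simp add: psd_mat_def cdot_self) (simp add: mat_adj_def mat_def vec_eq_iff)
qed

text \<open>Membership of \<open>m\<^sup>2 K\<^sup>2\<close> in the set of admissible constants follows from
  bounding the \<open>m\<^sup>2\<close> entries of \<open>A\<close> and \<open>B\<close> one by one; that every admissible constant is at least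
  \<open>m / K\<^sup>2\<close> follows from the pair \<open>A = B = I\<close>.\<close>

lemma gamma_const_ge:
  fixes N :: "complex^'m \<Rightarrow> real"
  assumes lo: "\<And>v. norm v \<le> N v" and hi: "\<And>v. N v \<le> K * norm v" and K: "0 < K"
  shows "real CARD('m) / K\<^sup>2 \<le> gamma_const N"
proof -
  let ?D = "{x. dual_norm N x \<le> 1}" and ?B = "{x. N x \<le> 1}"
  note dual = dual_norm_bounds[of N K, OF lo hi K]
  have D: "cball 0 1 \<subseteq> ?D" "?D \<subseteq> cball 0 K"
  proof safe
    fix x assume "x \<in> cball (0 :: complex^'m) 1"
    then show "dual_norm N x \<le> 1" using dual(1)[of x] by simp
  next
    fix x assume "dual_norm N x \<le> 1"
    then have "K * dual_norm N x \<le> K * 1" using K by (intro mult_left_mono) auto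
    then show "x \<in> cball 0 K" using dual(2)[of x] by simp
  qed
  have B: "cball 0 (1 / K) \<subseteq> ?B" "?B \<subseteq> cball 0 1"
  proof safe
    fix x assume "x \<in> cball (0 :: complex^'m) (1 / K)"
    then show "N x \<le> 1" using hi[of x] K by (simp add: field_simps)
  next
    fix x assume "N x \<le> 1"
    then show "x \<in> cball 0 1" using lo[of x] by simp
  qed
  define G where "G = {c. \<forall>A B. psd_mat A \<longrightarrow> psd_mat B \<longrightarrow>
     Re (\<Sum>i\<in>UNIV. \<Sum>j\<in>UNIV. A $ i $ j * B $ i $ j) \<le> c * inj_norm N A * inj_norm_dual N B}"
  have A_entry: "cmod (A $ i $ j) \<le> inj_norm N A" for A i j
    using entry_le_sesq_sup[OF D(2,1), of A i j] by (simp add: inj_norm_eq_sesq_sup)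
  have B_entry: "cmod (B $ i $ j) \<le> K\<^sup>2 * inj_norm_dual N B" for B i j
    using entry_le_sesq_sup[OF B(2,1), of B i j] K
    by (simp add: inj_norm_dual_eq_sesq_sup power_divide field_simps)
  have "(real CARD('m))\<^sup>2 * K\<^sup>2 \<in> G"
    unfolding G_def
  proof safe
    fix A B :: "complex^'m^'m"
    have "Re (\<Sum>i\<in>UNIV. \<Sum>j\<in>UNIV. A $ i $ j * B $ i $ j)
        \<le> cmod (\<Sum>i\<in>UNIV. \<Sum>j\<in>UNIV. A $ i $ j * B $ i $ j)"
      by (rule complex_Re_le_cmod)
    also have "\<dots> \<le> (\<Sum>i\<in>(UNIV::'m set). \<Sum>j\<in>(UNIV::'m set). inj_norm N A * (K\<^sup>2 * inj_norm_dual N B))"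
    proof (intro sum_norm_le)
      fix i j
      show "cmod (A $ i $ j * B $ i $ j) \<le> inj_norm N A * (K\<^sup>2 * inj_norm_dual N B)"
        unfolding norm_mult by (intro mult_mono A_entry B_entry order_trans[OF norm_ge_zero A_entry[of A i j]]) auto
    qed
    also have "\<dots> = (real CARD('m))\<^sup>2 * K\<^sup>2 * inj_norm N A * inj_norm_dual N B"
      by (simp add: power2_eq_square)
    finally show "Re (\<Sum>i\<in>UNIV. \<Sum>j\<in>UNIV. A $ i $ j * B $ i $ j) \<le>
      (real CARD('m))\<^sup>2 * K\<^sup>2 * inj_norm N A * inj_norm_dual N B" .
  qed
  then have ne: "G \<noteq> {}" by blast
  have "real CARD('m) / K\<^sup>2 \<le> c" if "c \<in> G" for c
  proof -
    let ?I = "mat 1 :: complex^'m^'m"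
    have "(\<Sum>i\<in>UNIV. \<Sum>j\<in>UNIV. ?I $ i $ j * ?I $ i $ j) =
        (\<Sum>i\<in>(UNIV :: 'm set). \<Sum>j\<in>UNIV. if i = j then 1 else 0)"
      by (intro sum.cong) (auto simp: mat_def)
    then have one: "Re (\<Sum>i\<in>UNIV. \<Sum>j\<in>UNIV. ?I $ i $ j * ?I $ i $ j) = CARD('m)" by simp
    have main: "real CARD('m) \<le> c * (inj_norm N ?I * inj_norm_dual N ?I)"
    proof -
      have "Re (\<Sum>i\<in>UNIV. \<Sum>j\<in>UNIV. ?I $ i $ j * ?I $ i $ j) \<le> c * inj_norm N ?I * inj_norm_dual N ?I"
        using that unfolding G_def by (blast intro: psd_mat_1)
      with one show ?thesis by (simp only: mult.assoc)
    qed
    obtain k :: 'm where True by blast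
    have A1: "1 \<le> inj_norm N ?I" using A_entry[of ?I k k] by (simp add: mat_def)
    have B0: "0 \<le> inj_norm_dual N ?I"
      using order_trans[OF norm_ge_zero B_entry[of ?I k k]] K by (simp add: zero_le_mult_iff)
    have "0 \<in> ?D" "0 \<in> ?B"
      using subsetD[OF D(1), of 0] subsetD[OF B(1), of 0] K by simp_all
    then have nonempty: "?D \<noteq> {}" "?B \<noteq> {}" by blast+
    have AK: "inj_norm N ?I \<le> K\<^sup>2"
      unfolding inj_norm_eq_sesq_sup using D(2) nonempty(1) by (rule sesq_sup_mat_1_le)
    have BK: "inj_norm_dual N ?I \<le> 1\<^sup>2"
      unfolding inj_norm_dual_eq_sesq_sup using B(2) nonempty(2) by (rule sesq_sup_mat_1_le)
    have prod: "0 \<le> inj_norm N ?I * inj_norm_dual N ?I"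
      using A1 B0 by simp
    have prod_le: "inj_norm N ?I * inj_norm_dual N ?I \<le> K\<^sup>2 * 1\<^sup>2"
      using AK BK B0 by (intro mult_mono) auto
    \<comment> \<open>An upper bound for the two norms bounds the right-hand side only once the sign of \<open>c\<close> is
      known.\<close>
    have "c \<ge> 0"
    proof (rule ccontr)
      assume "\<not> c \<ge> 0"
      then have "c * (inj_norm N ?I * inj_norm_dual N ?I) \<le> 0"
        using prod by (intro mult_nonpos_nonneg) auto
      with main have "real CARD('m) \<le> 0" by linarith
      then show False by simp
    qed
    then have "c * (inj_norm N ?I * inj_norm_dual N ?I) \<le> c * K\<^sup>2"
      using prod_le by (intro mult_left_mono) auto
    with main show ?thesis using K by (simp add: field_simps)
  qed
  then show ?thesis
    unfolding gamma_const_def G_def[symmetric] using ne by (intro cInf_greatest)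
qed

section \<open>Schatten classes\<close>

lemma gamma_const_schatten_ge:
  assumes p: "1 \<le> p" "p \<le> 2"
  shows "real CARD('n) powr (3 - 2 / p) \<le>
    gamma_const (schatten_vec_norm p :: complex^('n::finite \<times> 'n) \<Rightarrow> real)"
proof -
  let ?n = "real CARD('n)"
  have "?n powr (3 - 2 / p) = ?n powr (2 - (2 / p - 1))" by (simp add: algebra_simps)
  also have "\<dots> = ?n powr 2 / ?n powr (2 / p - 1)" by (rule powr_diff)
  also have "\<dots> = real CARD('n \<times> 'n) / (?n powr (1 / p - 1 / 2))\<^sup>2"
    by (simp add: power2_eq_square powr_add[symmetric])
  also have "\<dots> \<le> gamma_const (schatten_vec_norm p :: complex^('n \<times> 'n) \<Rightarrow> real)"
    using schatten_vec_norm_bounds[OF p] by (intro gamma_const_ge) auto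
  finally show ?thesis .
qed

theorem proposition6p4:
  shows "real CARD('n::finite) \<le> gamma_const (schatten_vec_norm 1 :: complex^('n::finite \<times> 'n) \<Rightarrow> real) \<and>
    (\<forall>p p' :: real. 1 < p \<longrightarrow> p < 2 \<longrightarrow> 1 / p + 1 / p' = 1 \<longrightarrow>
       real CARD('n) powr (1 + 2 / p') \<le> gamma_const (schatten_vec_norm p :: complex^('n::finite \<times> 'n) \<Rightarrow> real))"
proof (intro conjI allI impI)
  show "real CARD('n) \<le> gamma_const (schatten_vec_norm 1 :: complex^('n \<times> 'n) \<Rightarrow> real)"
    using gamma_const_schatten_ge[of 1, where 'n = 'n] by simp
next
  fix p p' :: real
  assume p: "1 < p" "p < 2" and conj: "1 / p + 1 / p' = 1"
  have "1 / p' = 1 - 1 / p" using conj by simp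
  then have "1 + 2 / p' = 3 - 2 / p" by (simp add: divide_inverse)
  with p show "real CARD('n) powr (1 + 2 / p') \<le>
      gamma_const (schatten_vec_norm p :: complex^('n \<times> 'n) \<Rightarrow> real)"
    using gamma_const_schatten_ge[of p, where 'n = 'n] by simp
qed

end
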